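(* Let $\mathbf D=(D,\sqcup,\sqcap,\neg,\lrcorner,\top,\bot)$ be a fully contextual double Boolean algebra. Then the map $h:D\to\mathfrak R^T(\mathbb K^T_{pr}(\mathbf D))$, $h(x):=(F_{\neg x},I_x)$, is a dBa isomorphism from $\mathbf D$ onto the algebra $\underline{\mathfrak R}^T(\mathbb K^T_{pr}(\mathbf D))$ of clopen object oriented protoconcepts. In particular $\mathbf D$ is isomorphic to $\underline{\mathfrak R}^T(\mathbb K^T_{pr}(\mathbf D))$.
   Context: A double Boolean algebra (dBa) is an algebra $\mathbf{D}=(D,\sqcup,\sqcap,\neg,\lrcorner,\top,\bot)$ of type $(2,2,1,1,0,0)$ such that, with $x\vee y:=\neg(\neg x\sqcap\neg y)$ and $x\wedge y:=\lrcorner(\lrcorner x\sqcup\lrcorner y)$, for all $x,y,z\in D$: $(x\sqcap x)\sqcap y=x\sqcap y$; $x\sqcap y=y\sqcap x$; $x\sqcap(y\sqcap z)=(x\sqcap y)\sqcap z$; $\neg(x\sqcap x)=\neg x$; $x\sqcap(x\sqcup y)=x\sqcap x$; $x\sqcap(y\vee z)=(x\sqcap y)\vee(x\sqcap z)$; $x\sqcap(x\vee y)=x\sqcap x$; $\neg\neg(x\sqcap y)=x\sqcap y$; $x\sqcap\neg x=\bot$; $\neg\bot=\top\sqcap\top$; $\neg\top=\bot$; the duals $(x\sqcup x)\sqcup y=x\sqcup y$; $x\sqcup y=y\sqcup x$; $x\sqcup(y\sqcup z)=(x\sqcup y)\sqcup z$; $\lrcorner(x\sqcup x)=\lrcorner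 x$; $x\sqcup(x\sqcap y)=x\sqcup x$; $x\sqcup(y\wedge z)=(x\sqcup y)\wedge(x\sqcup z)$; $x\sqcup(x\wedge y)=x\sqcup x$; $\lrcorner\lrcorner(x\sqcup y)=x\sqcup y$; $x\sqcup\lrcorner x=\top$; $\lrcorner\top=\bot\sqcup\bot$; $\lrcorner\bot=\top$; and $(x\sqcap x)\sqcup(x\sqcap x)=(x\sqcup x)\sqcap(x\sqcup x)$. The quasi-order is $x\sqsubseteq y$ iff $x\sqcap y=x\sqcap x$ and $x\sqcup y=y\sqcup y$. Write $x_\sqcap:=x\sqcap x$, $x_\sqcup:=x\sqcup x$, $D_\sqcap:=\{x:x\sqcap x=x\}$, $D_\sqcup:=\{x:x\sqcup x=x\}$. $\mathbf D$ is contextual if $\sqsubseteq$ is a partial order, and fully contextual if it is contextual and for all $y\in D_\sqcap$, $x\in D_\sqcup$ with $y_\sqcup=x_\sqcap$ there is a unique $z\in D$ with $z_\sqcap=y$ and $z_\sqcup=x$. A dBa isomorphism is a bijection preserving $\sqcup,\sqcap,\neg,\lrcorner,\top,\bot$. A filter is $F\subseteq D$ closed under $\sqcap$ and upward closed for $\sqsubseteq$; an ideal is $I\subseteq D$ closed under $\sqcup$ and downward closed. A primary filter is a filter $F\ne D$ with $x\in F$ or $\neg x\in F$ for every $x$; a primary ideal is an ideal $I\ne D$ with $x\in I$ or $\lrcorner x\in I$ for every $x$. $\mathcal F_{pr}(\mathbf D)$, $\mathcal I_{pr}(\mathbf D)$ are the sets of these; $F_x:=\{F\in\mathcal F_{pr}(\mathbf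 D):x\in F\}$, $I_x:=\{I\in\mathcal I_{pr}(\mathbf D):x\in I\}$. $\mathcal T$ is the topology on $\mathcal F_{pr}(\mathbf D)$ with subbase of closed sets $\{F_x\}$, $\mathcal J$ the topology on $\mathcal I_{pr}(\mathbf D)$ with subbase of closed sets $\{I_x\}$; $\mathbb K^T_{pr}(\mathbf D):=((\mathcal F_{pr}(\mathbf D),\mathcal T),(\mathcal I_{pr}(\mathbf D),\mathcal J),\nabla)$ where $F\nabla I$ iff $F\cap I=\emptyset$. For a relation $R\subseteq G\times M$, $A\subseteq G$, $B\subseteq M$: $A^{\blacksquare}:=\{m:R^{-1}(m)\subseteq A\}$, $B^{\lozenge}:=\{g:R(g)\cap B\neq\emptyset\}$. An object oriented protoconcept is a pair $(A,B)$ with $A^{\blacksquare\lozenge}=B^{\lozenge}$. Operations on pairs: $(A,B)\sqcap(C,D)=(A\cup C,(A\cup C)^{\blacksquare})$, $(A,B)\sqcup(C,D)=((B\cap D)^{\lozenge},B\cap D)$, $\neg(A,B)=(A^c,A^{c\blacksquare})$, $\lrcorner(A,B)=(B^{c\lozenge},B^c)$, $\top=(\emptyset,\emptyset)$, $\bot=(G,M)$. For a context on topological spaces $((G,\rho),(M,\tau),R)$, $\mathfrak R^T$ is the set of object oriented protoconcepts $(A,B)$ with $A$ clopen in $G$ and $B$ clopen in $M$, and $\underline{\mathfrak R}^T$ is this set with the operations above. *)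

theory Defs
  imports "HOL-Analysis.Abstract_Topology" "HOL-Algebra.Congruence"
begin

section \<open>Double Boolean algebras\<close>

record 'a dba = "'a partial_object" +
  djoin :: "'a \<Rightarrow> 'a \<Rightarrow> 'a"  (infixl "\<squnion>\<index>" 65)
  dmeet :: "'a \<Rightarrow> 'a \<Rightarrow> 'a"  (infixl "\<sqinter>\<index>" 70)
  dneg :: "'a \<Rightarrow> 'a"  ("\<^bold>\<not>\<index> _" [81] 80)
  dopp :: "'a \<Rightarrow> 'a"  ("\<^bold>\<rfloor>\<index> _" [81] 80)
  dtop :: 'a  ("\<top>\<index>")
  dbot :: 'a  ("\<bottom>\<index>")

definition dvee :: "('a, 'b) dba_scheme \<Rightarrow> 'a \<Rightarrow> 'a \<Rightarrow> 'a"  (infixl "\<^bold>\<or>\<index>" 65)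
  where "x \<^bold>\<or>\<^bsub>D\<^esub> y = \<^bold>\<not>\<^bsub>D\<^esub> (\<^bold>\<not>\<^bsub>D\<^esub> x \<sqinter>\<^bsub>D\<^esub> \<^bold>\<not>\<^bsub>D\<^esub> y)"

definition dwedge :: "('a, 'b) dba_scheme \<Rightarrow> 'a \<Rightarrow> 'a \<Rightarrow> 'a"  (infixl "\<^bold>\<and>\<index>" 70)
  where "x \<^bold>\<and>\<^bsub>D\<^esub> y = \<^bold>\<rfloor>\<^bsub>D\<^esub> (\<^bold>\<rfloor>\<^bsub>D\<^esub> x \<squnion>\<^bsub>D\<^esub> \<^bold>\<rfloor>\<^bsub>D\<^esub> y)"

definition dle :: "('a, 'b) dba_scheme \<Rightarrow> 'a \<Rightarrow> 'a \<Rightarrow> bool"  (infix "\<sqsubseteq>\<index>" 50)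
  where "x \<sqsubseteq>\<^bsub>D\<^esub> y \<longleftrightarrow> x \<sqinter>\<^bsub>D\<^esub> y = x \<sqinter>\<^bsub>D\<^esub> x \<and> x \<squnion>\<^bsub>D\<^esub> y = y \<squnion>\<^bsub>D\<^esub> y"

text \<open>The sets $D_\sqcap$ and $D_\sqcup$.\<close>

definition meet_part :: "('a, 'b) dba_scheme \<Rightarrow> 'a set"
  where "meet_part D = {x \<in> carrier D. x \<sqinter>\<^bsub>D\<^esub> x = x}"

definition join_part :: "('a, 'b) dba_scheme \<Rightarrow> 'a set"
  where "join_part D = {x \<in> carrier D. x \<squnion>\<^bsub>D\<^esub> x = x}"

locale double_boolean_algebra =
  fixes D (structure)
  assumes join_closed: "\<lbrakk>x \<in> carrier D; y \<in> carrier D\<rbrakk> \<Longrightarrow> x \<squnion> y \<in> carrier D"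
    and meet_closed: "\<lbrakk>x \<in> carrier D; y \<in> carrier D\<rbrakk> \<Longrightarrow> x \<sqinter> y \<in> carrier D"
    and neg_closed: "x \<in> carrier D \<Longrightarrow> \<^bold>\<not> x \<in> carrier D"
    and opp_closed: "x \<in> carrier D \<Longrightarrow> \<^bold>\<rfloor> x \<in> carrier D"
    and top_closed: "\<top> \<in> carrier D"
    and bot_closed: "\<bottom> \<in> carrier D"
    and meet_idem_left: "\<lbrakk>x \<in> carrier D; y \<in> carrier D\<rbrakk> \<Longrightarrow> (x \<sqinter> x) \<sqinter> y = x \<sqinter> y"
    and meet_comm: "\<lbrakk>x \<in> carrier D; y \<in> carrier D\<rbrakk> \<Longrightarrow> x \<sqinter> y = y \<sqinter> x"
    and meet_assoc: "\<lbrakk>x \<in> carrier D; y \<in> carrier D; z \<in> carrier D\<rbrakk>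
          \<Longrightarrow> x \<sqinter> (y \<sqinter> z) = (x \<sqinter> y) \<sqinter> z"
    and neg_meet_idem: "x \<in> carrier D \<Longrightarrow> \<^bold>\<not> (x \<sqinter> x) = \<^bold>\<not> x"
    and meet_join_absorb: "\<lbrakk>x \<in> carrier D; y \<in> carrier D\<rbrakk> \<Longrightarrow> x \<sqinter> (x \<squnion> y) = x \<sqinter> x"
    and meet_vee_distrib: "\<lbrakk>x \<in> carrier D; y \<in> carrier D; z \<in> carrier D\<rbrakk>
          \<Longrightarrow> x \<sqinter> (y \<^bold>\<or> z) = (x \<sqinter> y) \<^bold>\<or> (x \<sqinter> z)"
    and meet_vee_absorb: "\<lbrakk>x \<in> carrier D; y \<in> carrier D\<rbrakk> \<Longrightarrow> x \<sqinter> (x \<^bold>\<or> y) = x \<sqinter> x"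
    and neg_neg_meet: "\<lbrakk>x \<in> carrier D; y \<in> carrier D\<rbrakk> \<Longrightarrow> \<^bold>\<not> (\<^bold>\<not> (x \<sqinter> y)) = x \<sqinter> y"
    and meet_neg: "x \<in> carrier D \<Longrightarrow> x \<sqinter> \<^bold>\<not> x = \<bottom>"
    and neg_bot: "\<^bold>\<not> \<bottom> = \<top> \<sqinter> \<top>"
    and neg_top: "\<^bold>\<not> \<top> = \<bottom>"
    and join_idem_left: "\<lbrakk>x \<in> carrier D; y \<in> carrier D\<rbrakk> \<Longrightarrow> (x \<squnion> x) \<squnion> y = x \<squnion> y"
    and join_comm: "\<lbrakk>x \<in> carrier D; y \<in> carrier D\<rbrakk> \<Longrightarrow> x \<squnion> y = y \<squnion> x"
    and join_assoc: "\<lbrakk>x \<in> carrier D; y \<in> carrier D; z \<in> carrier D\<rbrakk>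
          \<Longrightarrow> x \<squnion> (y \<squnion> z) = (x \<squnion> y) \<squnion> z"
    and opp_join_idem: "x \<in> carrier D \<Longrightarrow> \<^bold>\<rfloor> (x \<squnion> x) = \<^bold>\<rfloor> x"
    and join_meet_absorb: "\<lbrakk>x \<in> carrier D; y \<in> carrier D\<rbrakk> \<Longrightarrow> x \<squnion> (x \<sqinter> y) = x \<squnion> x"
    and join_wedge_distrib: "\<lbrakk>x \<in> carrier D; y \<in> carrier D; z \<in> carrier D\<rbrakk>
          \<Longrightarrow> x \<squnion> (y \<^bold>\<and> z) = (x \<squnion> y) \<^bold>\<and> (x \<squnion> z)"
    and join_wedge_absorb: "\<lbrakk>x \<in> carrier D; y \<in> carrier D\<rbrakk> \<Longrightarrow> x \<squnion> (x \<^bold>\<and> y) = x \<squnion> x"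
    and opp_opp_join: "\<lbrakk>x \<in> carrier D; y \<in> carrier D\<rbrakk> \<Longrightarrow> \<^bold>\<rfloor> (\<^bold>\<rfloor> (x \<squnion> y)) = x \<squnion> y"
    and join_opp: "x \<in> carrier D \<Longrightarrow> x \<squnion> \<^bold>\<rfloor> x = \<top>"
    and opp_top: "\<^bold>\<rfloor> \<top> = \<bottom> \<squnion> \<bottom>"
    and opp_bot: "\<^bold>\<rfloor> \<bottom> = \<top>"
    and meet_join_idem: "x \<in> carrier D
          \<Longrightarrow> (x \<sqinter> x) \<squnion> (x \<sqinter> x) = (x \<squnion> x) \<sqinter> (x \<squnion> x)"

locale contextual_dba = double_boolean_algebra +
  assumes le_partial_order:
    "partial_order_on (carrier D) {(x, y). x \<in> carrier D \<and> y \<in> carrier D \<and> x \<sqsubseteq> y}"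

locale fully_contextual_dba = contextual_dba +
  assumes ex1_glue: "\<lbrakk>y \<in> meet_part D; x \<in> join_part D; y \<squnion> y = x \<sqinter> x\<rbrakk>
    \<Longrightarrow> \<exists>!z. z \<in> carrier D \<and> z \<sqinter> z = y \<and> z \<squnion> z = x"

definition dba_iso :: "('a, 'c) dba_scheme \<Rightarrow> ('b, 'd) dba_scheme \<Rightarrow> ('a \<Rightarrow> 'b) set"
  where "dba_iso D E = {h. bij_betw h (carrier D) (carrier E) \<and>
    (\<forall>x\<in>carrier D. \<forall>y\<in>carrier D. h (x \<squnion>\<^bsub>D\<^esub> y) = h x \<squnion>\<^bsub>E\<^esub> h y) \<and>
    (\<forall>x\<in>carrier D. \<forall>y\<in>carrier D. h (x \<sqinter>\<^bsub>D\<^esub> y) = h x \<sqinter>\<^bsub>E\<^esub> h y) \<and>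
    (\<forall>x\<in>carrier D. h (\<^bold>\<not>\<^bsub>D\<^esub> x) = \<^bold>\<not>\<^bsub>E\<^esub> h x) \<and>
    (\<forall>x\<in>carrier D. h (\<^bold>\<rfloor>\<^bsub>D\<^esub> x) = \<^bold>\<rfloor>\<^bsub>E\<^esub> h x) \<and>
    h \<top>\<^bsub>D\<^esub> = \<top>\<^bsub>E\<^esub> \<and> h \<bottom>\<^bsub>D\<^esub> = \<bottom>\<^bsub>E\<^esub>}"

definition dba_isomorphic :: "('a, 'c) dba_scheme \<Rightarrow> ('b, 'd) dba_scheme \<Rightarrow> bool"
  where "dba_isomorphic D E \<longleftrightarrow> dba_iso D E \<noteq> {}"

lemma (in double_boolean_algebra) dba_iso_imp_dba:
  assumes "h \<in> dba_iso D E"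
  shows "double_boolean_algebra E"
proof -
  have bij: "bij_betw h (carrier D) (carrier E)"
    and hom: "\<And>x y. \<lbrakk>x \<in> carrier D; y \<in> carrier D\<rbrakk> \<Longrightarrow> h x \<squnion>\<^bsub>E\<^esub> h y = h (x \<squnion> y)"
      "\<And>x y. \<lbrakk>x \<in> carrier D; y \<in> carrier D\<rbrakk> \<Longrightarrow> h x \<sqinter>\<^bsub>E\<^esub> h y = h (x \<sqinter> y)"
      "\<And>x. x \<in> carrier D \<Longrightarrow> \<^bold>\<not>\<^bsub>E\<^esub> h x = h (\<^bold>\<not> x)"
      "\<And>x. x \<in> carrier D \<Longrightarrow> \<^bold>\<rfloor>\<^bsub>E\<^esub> h x = h (\<^bold>\<rfloor> x)"
      "\<top>\<^bsub>E\<^esub> = h \<top>" "\<bottom>\<^bsub>E\<^esub> = h \<bottom>"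
    using assms by (auto simp: dba_iso_def)
  have carr: "carrier E = h ` carrier D"
    using bij by (simp add: bij_betw_def)
  note closed = join_closed meet_closed neg_closed opp_closed top_closed bot_closed
  have vee: "h x \<^bold>\<or>\<^bsub>E\<^esub> h y = h (x \<^bold>\<or> y)" "h x \<^bold>\<and>\<^bsub>E\<^esub> h y = h (x \<^bold>\<and> y)"
    "x \<^bold>\<or> y \<in> carrier D" "x \<^bold>\<and> y \<in> carrier D"
    if "x \<in> carrier D" "y \<in> carrier D" for x y
    using that by (simp_all add: dvee_def dwedge_def hom closed)
  show ?thesis
    by unfold_locales
      (auto simp: carr hom vee closed meet_idem_left neg_meet_idem meet_join_absorb
          meet_vee_distrib[symmetric] meet_vee_absorb neg_neg_meet meet_neg neg_bot neg_top
          join_idem_left opp_join_idem join_meet_absorb join_wedge_distrib[symmetric]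
          join_wedge_absorb opp_opp_join join_opp opp_top opp_bot meet_join_idem
          meet_assoc join_assoc
        intro: meet_comm[THEN arg_cong[where f = h]] join_comm[THEN arg_cong[where f = h]])
qed


section \<open>Primary filters and ideals\<close>

definition dba_filter :: "('a, 'b) dba_scheme \<Rightarrow> 'a set \<Rightarrow> bool"
  where "dba_filter D F \<longleftrightarrow> F \<subseteq> carrier D \<and> (\<forall>x\<in>F. \<forall>y\<in>F. x \<sqinter>\<^bsub>D\<^esub> y \<in> F) \<and>
    (\<forall>x\<in>F. \<forall>y\<in>carrier D. x \<sqsubseteq>\<^bsub>D\<^esub> y \<longrightarrow> y \<in> F)"

definition dba_ideal :: "('a, 'b) dba_scheme \<Rightarrow> 'a set \<Rightarrow> bool"
  where "dba_ideal D I \<longleftrightarrow> I \<subseteq> carrier D \<and> (\<forall>x\<in>I. \<forall>y\<in>I. x \<squnion>\<^bsub>D\<^esub> y \<in> I) \<and>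
    (\<forall>x\<in>I. \<forall>y\<in>carrier D. y \<sqsubseteq>\<^bsub>D\<^esub> x \<longrightarrow> y \<in> I)"

definition primary_filters :: "('a, 'b) dba_scheme \<Rightarrow> 'a set set"
  where "primary_filters D =
    {F. dba_filter D F \<and> F \<noteq> carrier D \<and> (\<forall>x\<in>carrier D. x \<in> F \<or> \<^bold>\<not>\<^bsub>D\<^esub> x \<in> F)}"

definition primary_ideals :: "('a, 'b) dba_scheme \<Rightarrow> 'a set set"
  where "primary_ideals D =
    {I. dba_ideal D I \<and> I \<noteq> carrier D \<and> (\<forall>x\<in>carrier D. x \<in> I \<or> \<^bold>\<rfloor>\<^bsub>D\<^esub> x \<in> I)}"

definition filters_at :: "('a, 'b) dba_scheme \<Rightarrow> 'a \<Rightarrow> 'a set set"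
  where "filters_at D x = {F \<in> primary_filters D. x \<in> F}"

definition ideals_at :: "('a, 'b) dba_scheme \<Rightarrow> 'a \<Rightarrow> 'a set set"
  where "ideals_at D x = {I \<in> primary_ideals D. x \<in> I}"

text \<open>The coarsest topology on \<open>X\<close> in which every member of \<open>\<C>\<close> (a family of subsets
  of \<open>X\<close>) is closed.\<close>

definition closed_subbase_topology :: "'a set \<Rightarrow> 'a set set \<Rightarrow> 'a topology"
  where "closed_subbase_topology X \<C> = topology
    (arbitrary union_of (finite intersection_of (\<lambda>U. \<exists>C\<in>\<C>. U = X - C) relative_to X))"


section \<open>Contexts on topological spaces and object oriented protoconcepts\<close>

record ('g, 'm) top_context =
  obj_top :: "'g topology"
  attr_top :: "'m topology"
  incidence :: "('g \<times> 'm) set"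

text \<open>The operators $A^{\blacksquare}$ and $B^{\lozenge}$.\<close>

definition nec :: "('g, 'm, 'z) top_context_scheme \<Rightarrow> 'g set \<Rightarrow> 'm set"
  where "nec K A = {m \<in> topspace (attr_top K). (incidence K)\<inverse> `` {m} \<subseteq> A}"

definition poss :: "('g, 'm, 'z) top_context_scheme \<Rightarrow> 'm set \<Rightarrow> 'g set"
  where "poss K B = {g \<in> topspace (obj_top K). incidence K `` {g} \<inter> B \<noteq> {}}"

definition oo_protoconcepts :: "('g, 'm, 'z) top_context_scheme \<Rightarrow> ('g set \<times> 'm set) set"
  where "oo_protoconcepts K = {(A, B). A \<subseteq> topspace (obj_top K) \<and> B \<subseteq> topspace (attr_top K) \<and>
    poss K (nec K A) = poss K B}"

definition clopen_oo_protoconcepts :: "('g, 'm, 'z) top_context_scheme \<Rightarrow> ('g set \<times> 'm set) set"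
  where "clopen_oo_protoconcepts K = {(A, B) \<in> oo_protoconcepts K.
    closedin (obj_top K) A \<and> openin (obj_top K) A \<and>
    closedin (attr_top K) B \<and> openin (attr_top K) B}"

definition clopen_oo_protoconcept_algebra ::
    "('g, 'm, 'z) top_context_scheme \<Rightarrow> ('g set \<times> 'm set) dba"
  where "clopen_oo_protoconcept_algebra K = \<lparr>
    carrier = clopen_oo_protoconcepts K,
    djoin = (\<lambda>(A, B) (C, E). (poss K (B \<inter> E), B \<inter> E)),
    dmeet = (\<lambda>(A, B) (C, E). (A \<union> C, nec K (A \<union> C))),
    dneg = (\<lambda>(A, B). (topspace (obj_top K) - A, nec K (topspace (obj_top K) - A))),
    dopp = (\<lambda>(A, B). (poss K (topspace (attr_top K) - B), topspace (attr_top K) - B)),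
    dtop = ({}, {}),
    dbot = (topspace (obj_top K), topspace (attr_top K))\<rparr>"

definition primary_context :: "('a, 'b) dba_scheme \<Rightarrow> ('a set, 'a set) top_context"
  where "primary_context D = \<lparr>
    obj_top = closed_subbase_topology (primary_filters D) (filters_at D ` carrier D),
    attr_top = closed_subbase_topology (primary_ideals D) (ideals_at D ` carrier D),
    incidence = {(F, I). F \<in> primary_filters D \<and> I \<in> primary_ideals D \<and> F \<inter> I = {}}\<rparr>"

lemma topspace_primary_context [simp]:
  "topspace (obj_top (primary_context D)) = primary_filters D"
  "topspace (attr_top (primary_context D)) = primary_ideals D"
  by (simp_all add: primary_context_def closed_subbase_topology_def topspace_subbase)

end

theory Submission
  imports Defs
begin

text \<open>Inside $D$ sits the Boolean algebra $D_\sqcap$, and primary filters behave like its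
  ultrafilters: a filter maximal among those avoiding a nonempty down-set $J$ closed under
  $\vee$ is primary. Three choices of $J$ carry the argument. Taking $J$ to be a primary ideal
  shows that the incidence relation computes $\blacksquare$ and $\lozenge$ correctly on $h(x)$;
  taking $J = \{w : w \sqcap y = w \sqcap w\}$ separates points of $D_\sqcap$; and for a clopen
  set $A$, taking $J$ to be the set of $w$ for which $F_w \cap A$ has the form $F_a$ shows that
  $A$ itself has this form, which replaces a compactness argument. The statements for ideals
  follow by duality, and full contextuality glues the two components of a clopen protoconcept.\<close>

section \<open>Duality\<close>

definition dual_dba :: "('a, 'b) dba_scheme \<Rightarrow> 'a dba"
  where "dual_dba D = \<lparr>carrier = carrier D, djoin = dmeet D, dmeet = djoin D,
    dneg = dopp D, dopp = dneg D, dtop = dbot D, dbot = dtop D\<rparr>"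

lemma dual_dba_simps [simp]:
  "carrier (dual_dba D) = carrier D"
  "x \<squnion>\<^bsub>dual_dba D\<^esub> y = x \<sqinter>\<^bsub>D\<^esub> y"
  "x \<sqinter>\<^bsub>dual_dba D\<^esub> y = x \<squnion>\<^bsub>D\<^esub> y"
  "\<^bold>\<not>\<^bsub>dual_dba D\<^esub> x = \<^bold>\<rfloor>\<^bsub>D\<^esub> x"
  "\<^bold>\<rfloor>\<^bsub>dual_dba D\<^esub> x = \<^bold>\<not>\<^bsub>D\<^esub> x"
  "\<top>\<^bsub>dual_dba D\<^esub> = \<bottom>\<^bsub>D\<^esub>"
  "\<bottom>\<^bsub>dual_dba D\<^esub> = \<top>\<^bsub>D\<^esub>"
  by (simp_all add: dual_dba_def)

lemma dual_dba_vee_wedge [simp]: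
  "x \<^bold>\<or>\<^bsub>dual_dba D\<^esub> y = x \<^bold>\<and>\<^bsub>D\<^esub> y"
  "x \<^bold>\<and>\<^bsub>dual_dba D\<^esub> y = x \<^bold>\<or>\<^bsub>D\<^esub> y"
  by (simp_all add: dvee_def dwedge_def)

context double_boolean_algebra
begin

text \<open>The axioms come in dual pairs. Only \<open>meet_join_idem\<close> is its own dual, with
  its two sides exchanged, hence the symmetric version among the rules.\<close>

lemma dual: "double_boolean_algebra (dual_dba D)"
  by (unfold_locales; unfold dual_dba_simps dual_dba_vee_wedge)
    (rule join_closed meet_closed neg_closed opp_closed top_closed bot_closed
      meet_idem_left meet_comm meet_assoc neg_meet_idem meet_join_absorb meet_vee_distrib
      meet_vee_absorb neg_neg_meet meet_neg neg_bot neg_top join_idem_left join_comm join_assoc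
      opp_join_idem join_meet_absorb join_wedge_distrib join_wedge_absorb opp_opp_join
      join_opp opp_top opp_bot meet_join_idem meet_join_idem[symmetric]; assumption)+

lemma dual_le:
  assumes "x \<in> carrier D" "y \<in> carrier D"
  shows "x \<sqsubseteq>\<^bsub>dual_dba D\<^esub> y \<longleftrightarrow> y \<sqsubseteq> x"
  using assms by (auto simp: dle_def meet_comm join_comm)

lemma dual_filter: "dba_filter (dual_dba D) I \<longleftrightarrow> dba_ideal D I"
  unfolding dba_filter_def dba_ideal_def dual_dba_simps using dual_le by blast

lemma dual_ideal: "dba_ideal (dual_dba D) F \<longleftrightarrow> dba_filter D F"
  unfolding dba_filter_def dba_ideal_def dual_dba_simps using dual_le by blast

lemma dual_primary_filters: "primary_filters (dual_dba D) = primary_ideals D"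
  by (simp add: primary_filters_def primary_ideals_def dual_filter)

lemma dual_primary_ideals: "primary_ideals (dual_dba D) = primary_filters D"
  by (simp add: primary_filters_def primary_ideals_def dual_ideal)

lemma dual_filters_at: "filters_at (dual_dba D) x = ideals_at D x"
  by (simp add: filters_at_def ideals_at_def dual_primary_filters)

section \<open>Arithmetic of double Boolean algebras\<close>

lemmas closed [simp] = join_closed meet_closed neg_closed opp_closed top_closed bot_closed

lemma vee_closed [simp]: "\<lbrakk>x \<in> carrier D; y \<in> carrier D\<rbrakk> \<Longrightarrow> x \<^bold>\<or> y \<in> carrier D"
  by (simp add: dvee_def)

lemma meet_left_comm:
  assumes "x \<in> carrier D" "y \<in> carrier D" "z \<in> carrier D"
  shows "x \<sqinter> (y \<sqinter> z) = y \<sqinter> (x \<sqinter> z)"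
  using assms by (simp add: meet_assoc meet_comm[of x y])

lemma meet_left_idem:
  assumes "x \<in> carrier D" "y \<in> carrier D"
  shows "x \<sqinter> (x \<sqinter> y) = x \<sqinter> y"
  using assms by (simp add: meet_assoc meet_idem_left)

lemma meet_right_idem:
  assumes "x \<in> carrier D" "y \<in> carrier D"
  shows "x \<sqinter> (y \<sqinter> y) = x \<sqinter> y"
  using assms by (metis meet_closed meet_comm meet_idem_left)

text \<open>Ordered rewriting for an operation that is not idempotent: a repeated factor is dropped
  only while two factors remain, so \<open>x \<sqinter> x\<close> is a normal form.\<close>

lemmas meet_ac = meet_assoc[symmetric] meet_comm meet_left_comm meet_left_idem meet_right_idem

text \<open>Since double negation fixes every meet, three negations of x collapse to one, while two
  negations of an element y give \<open>y \<sqinter> y\<close>. Negations thus lie in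
  \<open>meet_part D\<close>.\<close>

lemma neg_idem: "x \<in> carrier D \<Longrightarrow> \<^bold>\<not> x \<sqinter> \<^bold>\<not> x = \<^bold>\<not> x"
  by (metis neg_closed neg_meet_idem neg_neg_meet)

lemma opp_idem: "x \<in> carrier D \<Longrightarrow> \<^bold>\<rfloor> x \<squnion> \<^bold>\<rfloor> x = \<^bold>\<rfloor> x"
  by (metis opp_closed opp_join_idem opp_opp_join)

lemma vee_idem:
  assumes "x \<in> carrier D" "y \<in> carrier D"
  shows "(x \<^bold>\<or> y) \<sqinter> (x \<^bold>\<or> y) = x \<^bold>\<or> y"
  using assms by (simp add: dvee_def neg_idem)

lemma vee_meet_self:
  assumes "x \<in> carrier D" "y \<in> carrier D"
  shows "(x \<sqinter> x) \<^bold>\<or> (y \<sqinter> y) = x \<^bold>\<or> y"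
  using assms by (simp add: dvee_def neg_meet_idem)

text \<open>Writing \<open>\<top>\<close> as the join of x with its opposite turns this into
  absorption.\<close>

lemma meet_top: "x \<in> carrier D \<Longrightarrow> x \<sqinter> \<top> = x \<sqinter> x"
  by (metis join_opp meet_join_absorb opp_closed)

lemma vee_neg: "x \<in> carrier D \<Longrightarrow> x \<^bold>\<or> \<^bold>\<not> x = \<top> \<sqinter> \<top>"
  by (simp add: dvee_def meet_neg neg_bot)

text \<open>The join half of the order comes for free: if
  \<open>x \<sqinter> y = x \<sqinter> x\<close>, then joining y with \<open>x \<sqinter> x\<close>
  is joining y with \<open>y \<sqinter> x\<close>, which absorption reduces to
  \<open>y \<squnion> y\<close>.\<close>

lemma meet_self_le_iff:
  assumes "x \<in> carrier D" "y \<in> carrier D"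
  shows "x \<sqinter> x \<sqsubseteq> y \<longleftrightarrow> x \<sqinter> y = x \<sqinter> x"
proof
  assume "x \<sqinter> x \<sqsubseteq> y"
  then show "x \<sqinter> y = x \<sqinter> x"
    using assms by (simp add: dle_def meet_ac)
next
  assume *: "x \<sqinter> y = x \<sqinter> x"
  have "y \<squnion> (y \<sqinter> x) = y \<squnion> y"
    using assms by (simp add: join_meet_absorb)
  then have "(x \<sqinter> x) \<squnion> y = y \<squnion> y"
    using assms * by (metis join_comm meet_closed meet_comm)
  with * show "x \<sqinter> x \<sqsubseteq> y"
    using assms by (simp add: dle_def meet_ac)
qed

lemma meet_le:
  assumes "x \<in> carrier D" "y \<in> carrier D"
  shows "x \<sqinter> y \<sqsubseteq> x"
  using meet_self_le_iff[of "x \<sqinter> y" x] assms by (simp add: meet_ac)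

lemma bot_le: "x \<in> carrier D \<Longrightarrow> \<bottom> \<sqsubseteq> x"
  using meet_le[of x "\<^bold>\<not> x"] by (simp add: meet_neg)

text \<open>Distributivity reduces the claim to absorption in each argument. It transfers the
  closure of ideals under \<open>\<squnion>\<close> to the Boolean join of the meet part.\<close>

lemma vee_le_join:
  assumes "x \<in> carrier D" "y \<in> carrier D"
  shows "x \<^bold>\<or> y \<sqsubseteq> x \<squnion> y"
proof -
  have "(x \<squnion> y) \<sqinter> x = x \<sqinter> x" "(x \<squnion> y) \<sqinter> y = y \<sqinter> y"
    using meet_join_absorb[of x y] meet_join_absorb[of y x] assms
    by (simp_all add: meet_comm[of "x \<squnion> y"] join_comm[of y x])
  then have "(x \<squnion> y) \<sqinter> (x \<^bold>\<or> y) = x \<^bold>\<or> y"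
    using assms by (simp add: meet_vee_distrib vee_meet_self)
  then show ?thesis
    using meet_self_le_iff[of "x \<^bold>\<or> y" "x \<squnion> y"] assms
    by (simp add: vee_idem meet_comm[of "x \<^bold>\<or> y"])
qed

section \<open>Existence of primary filters\<close>

text \<open>By \<open>meet_self_le_iff\<close> the condition on w says that w lies above
  \<open>s \<sqinter> s\<close>. The equational form makes both closure properties calculations with
  meets.\<close>

lemma filter_generated:
  assumes S: "S \<subseteq> carrier D" and meets: "\<And>s t. \<lbrakk>s \<in> S; t \<in> S\<rbrakk> \<Longrightarrow> s \<sqinter> t \<in> S"
  shows "dba_filter D {w \<in> carrier D. \<exists>s\<in>S. s \<sqinter> w = s \<sqinter> s}"
proof -
  have "\<exists>u\<in>S. u \<sqinter> (v \<sqinter> w) = u \<sqinter> u"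
    if "v \<in> carrier D" "w \<in> carrier D" "s \<in> S" "s \<sqinter> v = s \<sqinter> s" "t \<in> S" "t \<sqinter> w = t \<sqinter> t"
    for v w s t
  proof
    have carr: "s \<in> carrier D" "t \<in> carrier D" using S that by auto
    have "(s \<sqinter> t) \<sqinter> (v \<sqinter> w) = (s \<sqinter> v) \<sqinter> (t \<sqinter> w)"
      using that(1,2) carr by (simp add: meet_ac)
    also have "\<dots> = (s \<sqinter> t) \<sqinter> (s \<sqinter> t)"
      unfolding that using carr by (simp add: meet_ac)
    finally show "(s \<sqinter> t) \<sqinter> (v \<sqinter> w) = (s \<sqinter> t) \<sqinter> (s \<sqinter> t)" .
  qed (use that meets in blast)
  moreover have "s \<sqinter> w = s \<sqinter> s"
    if "v \<in> carrier D" "w \<in> carrier D" "s \<in> S" "s \<sqinter> v = s \<sqinter> s" "v \<sqsubseteq> w" for v w s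
  proof -
    have s: "s \<in> carrier D" using S that by auto
    have "s \<sqinter> w = (s \<sqinter> s) \<sqinter> w" using s that by (simp add: meet_idem_left)
    also have "\<dots> = s \<sqinter> (v \<sqinter> w)" using s that by (metis meet_assoc)
    also have "\<dots> = (s \<sqinter> v) \<sqinter> v" using s that by (simp add: dle_def meet_ac)
    also have "\<dots> = s \<sqinter> s" using s that by (simp add: meet_idem_left)
    finally show ?thesis .
  qed
  ultimately show ?thesis
    unfolding dba_filter_def mem_Collect_eq using meet_closed by blast
qed

lemma chain_Union_filter:
  assumes "\<And>F. F \<in> C \<Longrightarrow> dba_filter D F" and "\<And>F G. \<lbrakk>F \<in> C; G \<in> C\<rbrakk> \<Longrightarrow> F \<subseteq> G \<or> G \<subseteq> F"
  shows "dba_filter D (\<Union>C)"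
proof -
  have "x \<sqinter> y \<in> \<Union>C" if "F \<in> C" "G \<in> C" "x \<in> F" "y \<in> G" for F G x y
  proof -
    from that assms(2)[of F G] obtain H where "H \<in> C" "x \<in> H" "y \<in> H" by auto
    then show ?thesis using assms(1)[of H] by (auto simp: dba_filter_def)
  qed
  with assms(1) show ?thesis
    unfolding dba_filter_def by (meson Sup_least UnionE UnionI)
qed

text \<open>The Boolean prime ideal argument: Zorn gives F maximal among the filters through x that
  avoid J. If F missed both y and its negation, maximality would produce elements of J that combine,
  by distributivity, into an element of F. The hypothesis is on \<open>x \<sqinter> x\<close>
  because every filter through x contains it.\<close>

theorem primary_filter_avoiding:
  assumes J: "J \<subseteq> carrier D" "J \<noteq> {}"
    and down: "\<And>v w. \<lbrakk>w \<in> J; v \<in> carrier D; v \<sqsubseteq> w\<rbrakk> \<Longrightarrow> v \<in> J"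
    and vee: "\<And>v w. \<lbrakk>v \<in> J; w \<in> J\<rbrakk> \<Longrightarrow> v \<^bold>\<or> w \<in> J"
    and x: "x \<in> carrier D" "x \<sqinter> x \<notin> J"
  obtains F where "F \<in> primary_filters D" "x \<in> F" "F \<inter> J = {}"
proof -
  define \<A> where "\<A> = {F. dba_filter D F \<and> x \<in> F \<and> F \<inter> J = {}}"
  \<comment> \<open>If a generated filter meets J, then J already contains
    \<open>s \<sqinter> s\<close> for some generator s.\<close>
  have in_J: "s \<sqinter> s \<in> J" if "s \<in> carrier D" "w \<in> J" "s \<sqinter> w = s \<sqinter> s" for s w
    using down[of w "s \<sqinter> s"] that J by (auto simp: meet_self_le_iff subset_iff)
  \<comment> \<open>The generator is \<open>x \<sqinter> x\<close>, since the singleton of x need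
    not be closed under \<open>\<sqinter>\<close>.\<close>
  have "dba_filter D {w \<in> carrier D. \<exists>s\<in>{x \<sqinter> x}. s \<sqinter> w = s \<sqinter> s}" (is "dba_filter D ?P")
    by (rule filter_generated) (use x in \<open>auto simp: meet_ac\<close>)
  moreover have "x \<in> ?P" "?P \<inter> J = {}"
    using x in_J[of "x \<sqinter> x"] by (auto simp: meet_ac)
  ultimately have "\<A> \<noteq> {}"
    unfolding \<A>_def by blast
  moreover have "\<Union>C \<in> \<A>" if "C \<noteq> {}" "subset.chain \<A> C" for C
  proof -
    have "dba_filter D (\<Union>C)"
      using that by (intro chain_Union_filter) (auto simp: subset_chain_def \<A>_def)
    with that show ?thesis
      by (auto simp: subset_chain_def \<A>_def)
  qed
  ultimately obtain F where F: "F \<in> \<A>" and max: "\<And>G. \<lbrakk>G \<in> \<A>; F \<subseteq> G\<rbrakk> \<Longrightarrow> G = F"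
    using subset_Zorn_nonempty[of \<A>] by metis
  have filt: "dba_filter D F" and xF: "x \<in> F" and FJ: "F \<inter> J = {}"
    using F by (auto simp: \<A>_def)
  have Fc: "F \<subseteq> carrier D" and Fmeet: "\<And>u v. \<lbrakk>u \<in> F; v \<in> F\<rbrakk> \<Longrightarrow> u \<sqinter> v \<in> F"
    using filt by (auto simp: dba_filter_def)
  have meets_J: "\<exists>f\<in>F. f \<sqinter> y \<in> J" if y: "y \<in> carrier D" "y \<notin> F" for y
  proof -
    \<comment> \<open>The meets of y with members of F generate a filter strictly larger than F and
      still containing x; by maximality it must hit J.\<close>
    let ?S = "(\<lambda>f. f \<sqinter> y) ` F"
    let ?G = "{w \<in> carrier D. \<exists>s\<in>?S. s \<sqinter> w = s \<sqinter> s}"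
    have closed_S: "(f \<sqinter> y) \<sqinter> (g \<sqinter> y) \<in> ?S" if "f \<in> F" "g \<in> F" for f g
    proof -
      have "(f \<sqinter> y) \<sqinter> (g \<sqinter> y) = (f \<sqinter> g) \<sqinter> y"
        using that y Fc by (simp add: meet_ac subset_iff)
      then show ?thesis using Fmeet that by blast
    qed
    have "dba_filter D ?G"
      by (rule filter_generated) (use y Fc closed_S in auto)
    moreover have sub: "F \<subseteq> ?G" "y \<in> ?G"
      using y Fc xF by (force simp: meet_ac subset_iff)+
    moreover have "?G \<noteq> F" using y sub by blast
    ultimately obtain s w where "s \<in> ?S" "w \<in> J" "s \<sqinter> w = s \<sqinter> s"
      using max[of ?G] xF by (auto simp: \<A>_def)
    moreover from this obtain f where f: "f \<in> F" "s = f \<sqinter> y" by auto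
    ultimately have "(f \<sqinter> y) \<sqinter> (f \<sqinter> y) \<in> J"
      using in_J[of s w] y Fc by auto
    then show ?thesis
      using f y Fc by (intro bexI[where x = f]) (simp_all add: meet_ac subset_iff)
  qed
  have "y \<in> F \<or> \<^bold>\<not> y \<in> F" if y: "y \<in> carrier D" for y
  proof (rule ccontr)
    assume "\<not> ?thesis"
    then obtain f g where fg: "f \<in> F" "g \<in> F" "f \<sqinter> y \<in> J" "g \<sqinter> \<^bold>\<not> y \<in> J"
      using meets_J[of y] meets_J[of "\<^bold>\<not> y"] y by auto
    \<comment> \<open>With the common factor k both meets stay in J by downward closure, and
      distributivity applies: the Boolean join of y and its negation is
      \<open>\<top> \<sqinter> \<top>\<close>, so \<open>k \<sqinter> k\<close> falls into
      J.\<close>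
    define k where "k = f \<sqinter> g"
    have carr: "f \<in> carrier D" "g \<in> carrier D" "k \<in> carrier D"
      using fg Fc by (auto simp: k_def subset_iff)
    have "k \<sqinter> y \<sqsubseteq> f \<sqinter> y" "k \<sqinter> \<^bold>\<not> y \<sqsubseteq> g \<sqinter> \<^bold>\<not> y"
      using meet_le[of "f \<sqinter> y" g] meet_le[of "g \<sqinter> \<^bold>\<not> y" f] carr y
      by (simp_all add: k_def meet_ac)
    then have "k \<sqinter> y \<in> J" "k \<sqinter> \<^bold>\<not> y \<in> J"
      using down fg carr y by auto
    then have "k \<sqinter> (y \<^bold>\<or> \<^bold>\<not> y) \<in> J"
      using vee carr y by (simp add: meet_vee_distrib)
    moreover have "k \<sqinter> (y \<^bold>\<or> \<^bold>\<not> y) = k \<sqinter> k"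
      using carr y meet_top[of k]
      by (simp add: vee_neg meet_right_idem)
    ultimately have "k \<sqinter> k \<in> J" by simp
    moreover have "k \<sqinter> k \<in> F"
      unfolding k_def using Fmeet fg by blast
    ultimately show False
      using FJ by blast
  qed
  then have "F \<in> primary_filters D"
    using filt FJ J by (auto simp: primary_filters_def)
  with that xF FJ show thesis by blast
qed

section \<open>The sets of primary filters containing an element\<close>

lemma primary_filter_meet:
  assumes "F \<in> primary_filters D" "x \<in> carrier D" "y \<in> carrier D"
  shows "x \<sqinter> y \<in> F \<longleftrightarrow> x \<in> F \<and> y \<in> F"
proof -
  have "x \<sqinter> y \<sqsubseteq> x" "x \<sqinter> y \<sqsubseteq> y"
    using assms meet_le[of x y] meet_le[of y x] by (simp_all add: meet_comm)
  with assms show ?thesis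
    by (auto simp: primary_filters_def dba_filter_def)
qed

lemma primary_filter_bot: "F \<in> primary_filters D \<Longrightarrow> \<bottom> \<notin> F"
  using bot_le by (auto simp: primary_filters_def dba_filter_def)

lemma primary_filter_neg:
  assumes "F \<in> primary_filters D" "x \<in> carrier D"
  shows "\<^bold>\<not> x \<in> F \<longleftrightarrow> x \<notin> F"
proof -
  have "x \<sqinter> \<^bold>\<not> x \<notin> F"
    using assms by (simp add: meet_neg primary_filter_bot)
  with assms show ?thesis
    by (auto simp: primary_filter_meet primary_filters_def)
qed

lemma filters_at_meet:
  assumes "x \<in> carrier D" "y \<in> carrier D"
  shows "filters_at D (x \<sqinter> y) = filters_at D x \<inter> filters_at D y"
  using assms by (auto simp: filters_at_def primary_filter_meet)

lemma filters_at_neg: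
  "x \<in> carrier D \<Longrightarrow> filters_at D (\<^bold>\<not> x) = primary_filters D - filters_at D x"
  by (auto simp: filters_at_def primary_filter_neg)

lemma filters_at_subset: "filters_at D x \<subseteq> primary_filters D"
  by (auto simp: filters_at_def)

lemma filters_at_bot: "filters_at D \<bottom> = {}"
  by (auto simp: filters_at_def primary_filter_bot)

lemma filters_at_top: "filters_at D \<top> = primary_filters D"
  using filters_at_neg[of \<top>] filters_at_subset[of \<top>]
  by (auto simp: neg_top filters_at_bot)

lemma filters_at_vee:
  assumes "x \<in> carrier D" "y \<in> carrier D"
  shows "filters_at D (x \<^bold>\<or> y) = filters_at D x \<union> filters_at D y"
  using assms filters_at_subset[of x] filters_at_subset[of y]
  by (auto simp: dvee_def filters_at_neg filters_at_meet)

lemma filters_at_mono: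
  assumes "x \<in> carrier D" "y \<in> carrier D" "x \<sqsubseteq> y"
  shows "filters_at D x \<subseteq> filters_at D y"
  using assms by (auto simp: filters_at_def primary_filters_def dba_filter_def)

text \<open>Here J collects the w with \<open>w \<sqinter> w \<sqsubseteq> y\<close>. If the
  equation failed, \<open>x \<sqinter> x\<close> would lie outside J, and a primary filter through x
  avoiding J would omit y, which belongs to J.\<close>

lemma meet_eq_if_filters_at_subset:
  assumes xy: "x \<in> carrier D" "y \<in> carrier D" and sub: "filters_at D x \<subseteq> filters_at D y"
  shows "x \<sqinter> y = x \<sqinter> x"
proof (rule ccontr)
  assume ne: "x \<sqinter> y \<noteq> x \<sqinter> x"
  define J where "J = {w \<in> carrier D. w \<sqinter> y = w \<sqinter> w}"
  have down: "v \<in> J" if v: "v \<in> carrier D" "v \<sqsubseteq> w" and "w \<in> J" for v w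
  proof -
    have w: "w \<in> carrier D" "w \<sqinter> y = w \<sqinter> w" using that by (auto simp: J_def)
    have vw: "v \<sqinter> w = v \<sqinter> v" using v by (simp add: dle_def)
    have "v \<sqinter> y = (v \<sqinter> w) \<sqinter> y" using v xy by (simp add: vw meet_idem_left)
    also have "\<dots> = v \<sqinter> (w \<sqinter> w)" using v w xy by (simp add: meet_assoc[symmetric])
    also have "\<dots> = v \<sqinter> v" using v w by (simp add: meet_right_idem vw)
    finally show ?thesis using v by (simp add: J_def)
  qed
  have vee: "v \<^bold>\<or> w \<in> J" if "v \<in> J" "w \<in> J" for v w
  proof -
    have vw: "v \<in> carrier D" "w \<in> carrier D" "y \<sqinter> v = v \<sqinter> v" "y \<sqinter> w = w \<sqinter> w"
      using that xy by (auto simp: J_def meet_comm[of y])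
    then have "y \<sqinter> (v \<^bold>\<or> w) = v \<^bold>\<or> w"
      using xy by (simp add: meet_vee_distrib vee_meet_self)
    then show ?thesis
      using vw xy by (simp add: J_def vee_idem meet_comm[of _ y])
  qed
  have J: "y \<in> J" "J \<subseteq> carrier D" and xJ: "x \<sqinter> x \<notin> J"
    using xy ne by (auto simp: J_def meet_idem_left meet_right_idem)
  obtain F where "F \<in> primary_filters D" "x \<in> F" "F \<inter> J = {}"
    by (rule primary_filter_avoiding[of J x]) (use J xJ xy(1) down vee in blast)+
  with sub J show False
    by (auto simp: filters_at_def)
qed

lemma meet_self_eq_if_filters_at_eq:
  assumes "x \<in> carrier D" "y \<in> carrier D" "filters_at D x = filters_at D y"
  shows "x \<sqinter> x = y \<sqinter> y"
  using meet_eq_if_filters_at_subset[of x y] meet_eq_if_filters_at_subset[of y x] assms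
  by (simp add: meet_comm)

lemma primary_ideal_vee:
  assumes "I \<in> primary_ideals D" "x \<in> I" "y \<in> I"
  shows "x \<^bold>\<or> y \<in> I"
proof -
  have "x \<in> carrier D" "y \<in> carrier D" "x \<squnion> y \<in> I"
    using assms by (auto simp: primary_ideals_def dba_ideal_def)
  then show ?thesis
    using assms(1) vee_le_join[of x y] by (auto simp: primary_ideals_def dba_ideal_def)
qed

text \<open>A primary ideal qualifies as the set to avoid: it is a down-set, closed under the
  Boolean join by \<open>primary_ideal_vee\<close>, and nonempty because it contains x or its
  opposite.\<close>

lemma primary_filter_disjoint_from_ideal:
  assumes I: "I \<in> primary_ideals D" and x: "x \<in> carrier D" "x \<sqinter> x \<notin> I"
  obtains F where "F \<in> primary_filters D" "x \<in> F" "F \<inter> I = {}"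
proof (rule primary_filter_avoiding[of I x])
  show "I \<subseteq> carrier D" "I \<noteq> {}"
    using I x by (auto simp: primary_ideals_def dba_ideal_def)
qed (use I x primary_ideal_vee that in \<open>auto simp: primary_ideals_def dba_ideal_def\<close>)

section \<open>Clopen sets\<close>

text \<open>The complement of F_y is F of the negation of y, and finite intersections of such sets
  again have the form F_x, with \<open>\<top>\<close> for the empty intersection. So the closed
  subbase is also a base of open sets.\<close>

lemma openin_closed_subbase_topology_base:
  assumes "openin (closed_subbase_topology (primary_filters D) (filters_at D ` carrier D)) A"
    and "F \<in> A"
  obtains x where "x \<in> carrier D" "F \<in> filters_at D x" "filters_at D x \<subseteq> A"
proof -
  obtain \<U> where fin: "finite \<U>"
    and \<U>: "\<And>U. U \<in> \<U> \<Longrightarrow> \<exists>x\<in>carrier D. U = primary_filters D - filters_at D x"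
    and F: "F \<in> primary_filters D \<inter> \<Inter>\<U>" and sub: "primary_filters D \<inter> \<Inter>\<U> \<subseteq> A"
  proof -
    obtain U where U: "(finite intersection_of
        (\<lambda>U. \<exists>C\<in>filters_at D ` carrier D. U = primary_filters D - C)
        relative_to primary_filters D) U" "F \<in> U" "U \<subseteq> A"
      using assms unfolding closed_subbase_topology_def openin_subbase arbitrary_union_of_alt
      by blast
    then obtain \<U> where "finite \<U>" "U = primary_filters D \<inter> \<Inter>\<U>"
      "\<U> \<subseteq> Collect (\<lambda>U. \<exists>C\<in>filters_at D ` carrier D. U = primary_filters D - C)"
      unfolding relative_to_def intersection_of_def by blast
    with U that[of \<U>] show thesis by blast
  qed
  have "\<exists>x\<in>carrier D. filters_at D x = primary_filters D \<inter> \<Inter>\<U>"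
    using fin \<U>
  proof (induction \<U>)
    case empty
    show ?case using filters_at_top by (intro bexI[where x = \<top>]) simp_all
  next
    case (insert U \<U>)
    then obtain x y where "x \<in> carrier D" "filters_at D x = primary_filters D \<inter> \<Inter>\<U>"
      "y \<in> carrier D" "U = primary_filters D - filters_at D y"
      by (metis insertCI)
    then show ?case
      by (intro bexI[where x = "x \<sqinter> \<^bold>\<not> y"]) (auto simp: filters_at_meet filters_at_neg)
  qed
  with F sub that show thesis by auto
qed

lemma clopen_filters_at:
  assumes "x \<in> carrier D"
  defines "T \<equiv> closed_subbase_topology (primary_filters D) (filters_at D ` carrier D)"
  shows "closedin T (filters_at D x)" "openin T (filters_at D x)"
proof -
  have top: "topspace T = primary_filters D"
    unfolding T_def closed_subbase_topology_def by (simp add: topspace_subbase)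
  have op: "openin T (primary_filters D - filters_at D y)" if "y \<in> carrier D" for y
    unfolding T_def closed_subbase_topology_def openin_subbase
    using relative_to_inc[of "finite intersection_of
      (\<lambda>U. \<exists>C\<in>filters_at D ` carrier D. U = primary_filters D - C)"
      "primary_filters D - filters_at D y" "primary_filters D"] that
    by (intro arbitrary_union_of_inc)
      (auto simp: Int_absorb1 intro!: finite_intersection_of_inc)
  show "closedin T (filters_at D x)"
    using op[of x] assms(1) filters_at_subset by (simp add: closedin_def top)
  have "filters_at D x = primary_filters D - filters_at D (\<^bold>\<not> x)"
    using assms(1) filters_at_subset[of x] by (auto simp: filters_at_neg)
  then show "openin T (filters_at D x)"
    using op[of "\<^bold>\<not> x"] assms(1) by simp
qed

text \<open>It suffices that \<open>\<top> \<sqinter> \<top>\<close> belongs to J, because its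
  primary filters are all of them. Otherwise some primary filter would avoid J, which is impossible
  since A and its complement are both open.\<close>

lemma clopen_eq_filters_at:
  assumes "closedin (closed_subbase_topology (primary_filters D) (filters_at D ` carrier D)) A"
    and "openin (closed_subbase_topology (primary_filters D) (filters_at D ` carrier D)) A"
  obtains a where "a \<in> carrier D" "A = filters_at D a"
proof -
  let ?T = "closed_subbase_topology (primary_filters D) (filters_at D ` carrier D)"
  have top: "topspace ?T = primary_filters D"
    unfolding closed_subbase_topology_def by (simp add: topspace_subbase)
  have A: "A \<subseteq> primary_filters D" and compl: "openin ?T (primary_filters D - A)"
    using assms(1) by (auto simp: closedin_def top)
  define J where "J = {w \<in> carrier D. \<exists>a\<in>carrier D. filters_at D w \<inter> A = filters_at D a}"
  have down: "v \<in> J" if w: "w \<in> J" and v: "v \<in> carrier D" "v \<sqsubseteq> w" for v w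
  proof -
    obtain a where a: "a \<in> carrier D" "filters_at D w \<inter> A = filters_at D a"
      using w by (auto simp: J_def)
    \<comment> \<open>As F_v lies in F_w, cutting F_v with A is the same as cutting it with
      F_a.\<close>
    have "filters_at D v \<inter> A = filters_at D (v \<sqinter> a)"
      using filters_at_mono[of v w] w v a by (auto simp: filters_at_meet J_def)
    with v a show ?thesis by (auto simp: J_def intro!: bexI[where x = "v \<sqinter> a"])
  qed
  have vee: "v \<^bold>\<or> w \<in> J" if vw: "v \<in> J" "w \<in> J" for v w
  proof -
    obtain a b where ab: "a \<in> carrier D" "filters_at D v \<inter> A = filters_at D a"
      "b \<in> carrier D" "filters_at D w \<inter> A = filters_at D b"
      using vw by (auto simp: J_def)
    have "filters_at D (v \<^bold>\<or> w) \<inter> A = filters_at D (a \<^bold>\<or> b)"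
      using vw ab by (auto simp: filters_at_vee J_def)
    with vw ab show ?thesis by (auto simp: J_def intro!: bexI[where x = "a \<^bold>\<or> b"])
  qed
  have J: "\<bottom> \<in> J" "J \<subseteq> carrier D"
    using filters_at_bot by (auto simp: J_def intro!: bexI[where x = \<bottom>])
  have "\<top> \<sqinter> \<top> \<in> J"
  proof (rule ccontr)
    assume topJ: "\<top> \<sqinter> \<top> \<notin> J"
    obtain F where F: "F \<in> primary_filters D" "F \<inter> J = {}"
      by (rule primary_filter_avoiding[of J \<top>]) (use J topJ top_closed down vee in blast)+
    \<comment> \<open>F has a basic neighbourhood F_x inside A or disjoint from A. Then
      \<open>F_x \<inter> A\<close> is F_x or F_\<bottom>, which puts x into J although x lies in
      F.\<close>
    show False
    proof (cases "F \<in> A")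
      case True
      then obtain x where "x \<in> carrier D" "F \<in> filters_at D x" "filters_at D x \<subseteq> A"
        using openin_closed_subbase_topology_base[OF assms(2)] by blast
      then have "x \<in> F" "x \<in> J"
        by (auto simp: J_def filters_at_def[of D x] intro!: bexI[where x = x])
      with F show False by blast
    next
      case False
      then obtain x where x: "x \<in> carrier D" "F \<in> filters_at D x"
        "filters_at D x \<subseteq> primary_filters D - A"
        using openin_closed_subbase_topology_base[OF compl, of F] F by blast
      then have "filters_at D x \<inter> A = filters_at D \<bottom>"
        using filters_at_bot by auto
      with x have "x \<in> F" "x \<in> J"
        unfolding J_def by (auto simp: filters_at_def[of D x] intro!: bexI[where x = \<bottom>])
      with F show False by blast
    qed
  qed
  then obtain a where "a \<in> carrier D" "filters_at D (\<top> \<sqinter> \<top>) \<inter> A = filters_at D a"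
    by (auto simp: J_def)
  with A that show thesis
    by (auto simp: filters_at_meet filters_at_top Int_absorb1)
qed

section \<open>The canonical context\<close>

lemma incidence_primary_context:
  "(F, I) \<in> incidence (primary_context D)
    \<longleftrightarrow> F \<in> primary_filters D \<and> I \<in> primary_ideals D \<and> F \<inter> I = {}"
  by (simp add: primary_context_def)

text \<open>The left side consists of the primary ideals I such that no primary filter disjoint from
  I contains x. Such a filter exists if \<open>x \<sqinter> x \<notin> I\<close>; conversely, a
  filter through x contains \<open>x \<sqinter> x\<close> and so meets any I containing that
  element.\<close>

lemma nec_filters_at_neg:
  assumes "x \<in> carrier D"
  shows "nec (primary_context D) (filters_at D (\<^bold>\<not> x)) = ideals_at D (x \<sqinter> x)"
proof (intro equalityI subsetI)
  fix I assume "I \<in> nec (primary_context D) (filters_at D (\<^bold>\<not> x))"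
  then have I: "I \<in> primary_ideals D"
    and *: "\<And>F. \<lbrakk>F \<in> primary_filters D; F \<inter> I = {}\<rbrakk> \<Longrightarrow> x \<notin> F"
    using assms by (auto simp: nec_def incidence_primary_context filters_at_def primary_filter_neg)
  then have "x \<sqinter> x \<in> I"
    using primary_filter_disjoint_from_ideal[OF I assms] by blast
  with I show "I \<in> ideals_at D (x \<sqinter> x)"
    by (simp add: ideals_at_def)
next
  fix I assume I: "I \<in> ideals_at D (x \<sqinter> x)"
  have "x \<notin> F" if "F \<in> primary_filters D" "F \<inter> I = {}" for F
    using primary_filter_meet[of F x x] that I assms by (auto simp: ideals_at_def)
  then show "I \<in> nec (primary_context D) (filters_at D (\<^bold>\<not> x))"
    using I assms
    by (auto simp: nec_def incidence_primary_context filters_at_def ideals_at_def primary_filter_neg)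
qed

section \<open>Statements on primary ideals obtained by duality\<close>

lemmas primary_ideal_disjoint_from_filter =
  double_boolean_algebra.primary_filter_disjoint_from_ideal[OF dual,
    unfolded dual_primary_filters dual_primary_ideals dual_dba_simps]

lemmas primary_ideal_join =
  double_boolean_algebra.primary_filter_meet[OF dual,
    unfolded dual_primary_filters dual_dba_simps]

lemmas ideals_at_join =
  double_boolean_algebra.filters_at_meet[OF dual, unfolded dual_filters_at dual_dba_simps]

lemmas ideals_at_opp =
  double_boolean_algebra.filters_at_neg[OF dual,
    unfolded dual_filters_at dual_primary_filters dual_dba_simps]

lemmas ideals_at_top =
  double_boolean_algebra.filters_at_bot[OF dual, unfolded dual_filters_at dual_dba_simps]

lemmas ideals_at_bot =
  double_boolean_algebra.filters_at_top[OF dual,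
    unfolded dual_filters_at dual_primary_filters dual_dba_simps]

lemmas join_self_eq_if_ideals_at_eq =
  double_boolean_algebra.meet_self_eq_if_filters_at_eq[OF dual,
    unfolded dual_filters_at dual_dba_simps]

text \<open>In the subbase \<open>filters_at\<close> occurs unapplied, under an image over the
  carrier, so the equation is needed between functions.\<close>

lemma dual_filters_at_fun: "filters_at (dual_dba D) = ideals_at D"
  by (simp add: fun_eq_iff dual_filters_at)

lemmas clopen_ideals_at =
  double_boolean_algebra.clopen_filters_at[OF dual,
    unfolded dual_filters_at_fun dual_primary_filters dual_dba_simps]

lemmas clopen_eq_ideals_at =
  double_boolean_algebra.clopen_eq_filters_at[OF dual,
    unfolded dual_filters_at_fun dual_primary_filters dual_dba_simps]

text \<open>A primary ideal through x contains \<open>x \<squnion> x\<close>, so disjointness keeps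
  that element out of F. Conversely, when F omits it, the dual existence result yields an ideal
  through x disjoint from F.\<close>

lemma poss_ideals_at:
  assumes "x \<in> carrier D"
  shows "poss (primary_context D) (ideals_at D x) = filters_at D (\<^bold>\<not> (x \<squnion> x))"
proof (intro equalityI subsetI)
  fix F assume "F \<in> poss (primary_context D) (ideals_at D x)"
  then obtain I where F: "F \<in> primary_filters D" and I: "I \<in> primary_ideals D" "F \<inter> I = {}" "x \<in> I"
    by (auto simp: poss_def incidence_primary_context ideals_at_def)
  then have "x \<squnion> x \<in> I"
    using assms by (simp add: primary_ideal_join)
  with F I show "F \<in> filters_at D (\<^bold>\<not> (x \<squnion> x))"
    using assms by (auto simp: filters_at_def primary_filter_neg)
next
  fix F assume "F \<in> filters_at D (\<^bold>\<not> (x \<squnion> x))"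
  then have F: "F \<in> primary_filters D" "x \<squnion> x \<notin> F"
    using assms by (auto simp: filters_at_def primary_filter_neg)
  then obtain I where "I \<in> primary_ideals D" "x \<in> I" "F \<inter> I = {}"
    by (rule primary_ideal_disjoint_from_filter[OF _ assms, of F]) (auto simp: Int_commute)
  with F show "F \<in> poss (primary_context D) (ideals_at D x)"
    by (auto simp: poss_def incidence_primary_context ideals_at_def)
qed

lemma filters_at_neg_meet_self:
  "x \<in> carrier D \<Longrightarrow> filters_at D (\<^bold>\<not> (x \<sqinter> x)) = filters_at D (\<^bold>\<not> x)"
  by (simp add: neg_meet_idem)

lemma ideals_at_join_self: "x \<in> carrier D \<Longrightarrow> ideals_at D (x \<squnion> x) = ideals_at D x"
  by (simp add: ideals_at_join)

text \<open>This is the protoconcept condition for the image of x. The operators turn it into a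
  comparison of \<open>(x \<sqinter> x) \<squnion> (x \<sqinter> x)\<close> with
  \<open>x \<squnion> x\<close> under negation; \<open>meet_join_idem\<close> makes the former the
  meet of the latter with itself, which negation does not distinguish.\<close>

lemma poss_nec_filters_at_neg:
  assumes "x \<in> carrier D"
  shows "poss (primary_context D) (nec (primary_context D) (filters_at D (\<^bold>\<not> x)))
    = poss (primary_context D) (ideals_at D x)"
  using assms
  by (simp add: nec_filters_at_neg poss_ideals_at meet_join_idem filters_at_neg_meet_self)

lemma representation_in_clopen_oo_protoconcepts:
  assumes "x \<in> carrier D"
  shows "(filters_at D (\<^bold>\<not> x), ideals_at D x) \<in> clopen_oo_protoconcepts (primary_context D)"
proof -
  have "ideals_at D x \<subseteq> primary_ideals D"
    by (auto simp: ideals_at_def)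
  then show ?thesis
    using assms filters_at_subset[of "\<^bold>\<not> x"] clopen_filters_at[of "\<^bold>\<not> x"] clopen_ideals_at[of x]
    \<comment> \<open>The context stays folded in the first pass, because the equations for its
      operators and underlying sets are stated for \<open>primary_context D\<close>.\<close>
    by (simp add: clopen_oo_protoconcepts_def oo_protoconcepts_def poss_nec_filters_at_neg)
      (simp add: primary_context_def)
qed

end

section \<open>The representation is an isomorphism\<close>

text \<open>Elements with the same two parts lie below each other in the quasi-order, which is
  antisymmetric in the contextual case.\<close>

lemma (in contextual_dba) eq_if_parts_eq:
  assumes "x \<in> carrier D" "y \<in> carrier D" "x \<sqinter> x = y \<sqinter> y" "x \<squnion> x = y \<squnion> y"
  shows "x = y"
proof -
  have le: "v \<sqsubseteq> w"
    if "v \<in> carrier D" "w \<in> carrier D" "v \<sqinter> v = w \<sqinter> w" "v \<squnion> v = w \<squnion> w" for v w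
    unfolding dle_def using that by (metis join_idem_left meet_idem_left)
  have "antisym {(x, y). x \<in> carrier D \<and> y \<in> carrier D \<and> x \<sqsubseteq> y}"
    using le_partial_order by (simp add: partial_order_on_def)
  from antisymD[OF this] show ?thesis
    using le[of x y] le[of y x] assms by auto
qed

text \<open>The components are first represented separately, by p in the meet part and q in the join
  part. The protoconcept condition then becomes \<open>p \<squnion> p = q \<sqinter> q\<close>,
  exactly what gluing p and q requires.\<close>

lemma (in fully_contextual_dba) clopen_oo_protoconcept_representation:
  assumes "(A, B) \<in> clopen_oo_protoconcepts (primary_context D)"
  obtains z where "z \<in> carrier D" "A = filters_at D (\<^bold>\<not> z)" "B = ideals_at D z"
proof -
  let ?K = "primary_context D"
  have eq: "poss ?K (nec ?K A) = poss ?K B"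
    and A: "closedin (obj_top ?K) A" "openin (obj_top ?K) A"
    and B: "closedin (attr_top ?K) B" "openin (attr_top ?K) B"
    using assms by (auto simp: clopen_oo_protoconcepts_def oo_protoconcepts_def)
  obtain a where a: "a \<in> carrier D" "A = filters_at D a"
    using clopen_eq_filters_at A by (auto simp: primary_context_def)
  obtain b where b: "b \<in> carrier D" "B = ideals_at D b"
    using clopen_eq_ideals_at B by (auto simp: primary_context_def)
  \<comment> \<open>A must be the set of filters at a negation, and negating a twice does not change
    its filters. Likewise \<open>b \<squnion> b\<close> has the same ideals as b and lies in the
    join part.\<close>
  define p where "p = \<^bold>\<not> a"
  define q where "q = b \<squnion> b"
  have p: "p \<in> carrier D" "p \<sqinter> p = p" "A = filters_at D (\<^bold>\<not> p)"
    using a filters_at_subset[of a] by (auto simp: p_def neg_idem filters_at_neg)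
  have q: "q \<in> carrier D" "q \<squnion> q = q" "B = ideals_at D q"
    using b by (simp_all add: q_def join_idem_left join_assoc ideals_at_join_self)
  have "filters_at D (\<^bold>\<not> (p \<squnion> p)) = filters_at D (\<^bold>\<not> q)"
    using eq p q by (simp add: poss_nec_filters_at_neg poss_ideals_at)
  then have "\<^bold>\<not> (p \<squnion> p) = \<^bold>\<not> q"
    using meet_self_eq_if_filters_at_eq[of "\<^bold>\<not> (p \<squnion> p)" "\<^bold>\<not> q"] p q by (simp add: neg_idem)
  \<comment> \<open>Negating once more recovers the meet of each element with itself.\<close>
  then have "(p \<squnion> p) \<sqinter> (p \<squnion> p) = q \<sqinter> q"
    using p q by (metis join_closed neg_meet_idem neg_neg_meet)
  \<comment> \<open>Because \<open>p \<sqinter> p = p\<close>, the axiom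
    \<open>meet_join_idem\<close> shows that \<open>p \<squnion> p\<close> is idempotent for
    \<open>\<sqinter>\<close>.\<close>
  then have "p \<squnion> p = q \<sqinter> q"
    using p meet_join_idem[of p] by simp
  then obtain z where z: "z \<in> carrier D" "z \<sqinter> z = p" "z \<squnion> z = q"
    using ex1_glue[of p q] p q by (auto simp: meet_part_def join_part_def)
  show thesis
    using that[of z] z p q filters_at_neg_meet_self[of z] ideals_at_join_self[of z] by simp
qed

text \<open>The first component of the image determines \<open>x \<sqinter> x\<close> and the second
  determines \<open>x \<squnion> x\<close>, which gives injectivity; gluing gives surjectivity. For
  each of the four operations one component is a set identity, and the other comes from
  \<open>poss_ideals_at\<close> or \<open>nec_filters_at_neg\<close>, as the result is idempotent
  for the matching operation.\<close>

theorem (in fully_contextual_dba) representation_iso: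
  "(\<lambda>x. (filters_at D (\<^bold>\<not> x), ideals_at D x))
    \<in> dba_iso D (clopen_oo_protoconcept_algebra (primary_context D))"
proof -
  let ?K = "primary_context D"
  let ?h = "\<lambda>x. (filters_at D (\<^bold>\<not> x), ideals_at D x)"
  have "inj_on ?h (carrier D)"
  proof (rule inj_onI)
    fix x y assume xy: "x \<in> carrier D" "y \<in> carrier D" and eq: "?h x = ?h y"
    have "\<^bold>\<not> x = \<^bold>\<not> y"
      using meet_self_eq_if_filters_at_eq[of "\<^bold>\<not> x" "\<^bold>\<not> y"] xy eq by (simp add: neg_idem)
    then have "x \<sqinter> x = y \<sqinter> y"
      using neg_neg_meet[of x x] neg_neg_meet[of y y] neg_meet_idem[of x] neg_meet_idem[of y] xy
      by simp
    moreover have "x \<squnion> x = y \<squnion> y"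
      using eq by (intro join_self_eq_if_ideals_at_eq xy) simp
    ultimately show "x = y"
      using eq_if_parts_eq xy by blast
  qed
  moreover have "?h ` carrier D = clopen_oo_protoconcepts ?K"
  proof (intro equalityI subsetI)
    fix P assume "P \<in> clopen_oo_protoconcepts ?K"
    then show "P \<in> ?h ` carrier D"
      by (cases P) (auto elim: clopen_oo_protoconcept_representation)
  qed (use representation_in_clopen_oo_protoconcepts in blast)
  ultimately have "bij_betw ?h (carrier D) (clopen_oo_protoconcepts ?K)"
    by (simp add: bij_betw_def)
  moreover have "?h (x \<squnion> y) = (poss ?K (ideals_at D x \<inter> ideals_at D y), ideals_at D x \<inter> ideals_at D y)"
    if "x \<in> carrier D" "y \<in> carrier D" for x y
  proof -
    have "(x \<squnion> y) \<squnion> (x \<squnion> y) = x \<squnion> y"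
      using that by (metis join_closed opp_idem opp_closed opp_opp_join)
    then show ?thesis
      using poss_ideals_at[of "x \<squnion> y"] that by (simp add: ideals_at_join)
  qed
  moreover have "?h (x \<sqinter> y) = (filters_at D (\<^bold>\<not> x) \<union> filters_at D (\<^bold>\<not> y),
      nec ?K (filters_at D (\<^bold>\<not> x) \<union> filters_at D (\<^bold>\<not> y)))"
    if "x \<in> carrier D" "y \<in> carrier D" for x y
  proof -
    have "filters_at D (\<^bold>\<not> (x \<sqinter> y)) = filters_at D (\<^bold>\<not> x) \<union> filters_at D (\<^bold>\<not> y)"
      using that by (auto simp: filters_at_neg filters_at_meet)
    moreover have "(x \<sqinter> y) \<sqinter> (x \<sqinter> y) = x \<sqinter> y"
      using that by (simp add: meet_ac)
    ultimately show ?thesis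
      using nec_filters_at_neg[of "x \<sqinter> y"] that by simp
  qed
  moreover have "?h (\<^bold>\<not> x) = (primary_filters D - filters_at D (\<^bold>\<not> x),
      nec ?K (primary_filters D - filters_at D (\<^bold>\<not> x)))" if "x \<in> carrier D" for x
    using nec_filters_at_neg[of "\<^bold>\<not> x"] filters_at_neg[of "\<^bold>\<not> x"] that by (simp add: neg_idem)
  moreover have "?h (\<^bold>\<rfloor> x) = (poss ?K (primary_ideals D - ideals_at D x),
      primary_ideals D - ideals_at D x)" if "x \<in> carrier D" for x
    using poss_ideals_at[of "\<^bold>\<rfloor> x"] that by (simp add: opp_idem ideals_at_opp)
  moreover have "?h \<top> = ({}, {})"
    by (simp add: neg_top filters_at_bot ideals_at_top)
  moreover have "?h \<bottom> = (primary_filters D, primary_ideals D)"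
    by (simp add: neg_bot filters_at_meet filters_at_top ideals_at_bot)
  ultimately show ?thesis
    by (simp add: dba_iso_def clopen_oo_protoconcept_algebra_def)
qed

theorem mainTheorem2:
  fixes D :: "('a, 'b) dba_scheme"
  assumes "fully_contextual_dba D"
  shows "(\<lambda>x. (filters_at D (\<^bold>\<not>\<^bsub>D\<^esub> x), ideals_at D x))
           \<in> dba_iso D (clopen_oo_protoconcept_algebra (primary_context D))
         \<and> dba_isomorphic D (clopen_oo_protoconcept_algebra (primary_context D))"
  using fully_contextual_dba.representation_iso[OF assms] by (auto simp: dba_isomorphic_def)

end
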